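(* For a permutation $\pi$ of $\{1,\ldots,n\}$, let $s(\pi)$ be the minimum number $k$ of stacks such that $\pi$ can be sorted by $k$ stacks in sequential arrangement. Then, for $\pi$ uniformly random, $\mathbb{E}[s(\pi)]\ge \left(\tfrac12-o(1)\right)\log n$ as $n\to\infty$; i.e. on the average at least (asymptotically) $\tfrac12\log n$ stacks are needed for sequential stack sort.
   Context: $\log$ denotes the binary logarithm. Sorting with $k$ sequential stacks: there are $k$ initially empty stacks $S_0,\ldots,S_{k-1}$. The input is a permutation $\pi=(x_1,\ldots,x_n)$ of $\{1,\ldots,n\}$, read from left to right. At each step one may either (a) push the next unread input element onto $S_0$; or (b) for some $0\le i<k-1$, pop the top element of $S_i$ and push it onto $S_{i+1}$; or (c) pop the top element of $S_{k-1}$ and append it to the output. $\pi$ is sorted by $k$ sequential stacks if some sequence of such steps moves all elements to the output and the output is $1,2,\ldots,n$. (It is known that $\lceil\log n\rceil$ stacks always suffice, so $s(\pi)$ is finite.) *)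

theory Defs
  imports
    "HOL-Probability.Probability"
    "HOL-Combinatorics.Multiset_Permutations"
    "HOL-Library.Landau_Symbols"
begin

text \<open>
  A configuration consists of the unread input, the list of stacks \<open>S\<^sub>0, \<dots>, S\<^sub>k\<^sub>-\<^sub>1\<close> (the head of
  each stack being its top element), and the output in the order in which it was written.
\<close>

type_synonym config = "nat list \<times> nat list list \<times> nat list"

inductive stack_step :: "config \<Rightarrow> config \<Rightarrow> bool" where
  read_input: "0 < length S \<Longrightarrow>
    stack_step (x # inp, S, out) (inp, S[0 := x # S ! 0], out)"
| transfer: "Suc i < length S \<Longrightarrow> S ! i = x # xs \<Longrightarrow>
    stack_step (inp, S, out) (inp, S[i := xs, Suc i := x # S ! Suc i], out)"
| emit: "0 < length S \<Longrightarrow> S ! (length S - 1) = x # xs \<Longrightarrow>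
    stack_step (inp, S, out) (inp, S[length S - 1 := xs], out @ [x])"

definition seq_stack_sortable :: "nat \<Rightarrow> nat list \<Rightarrow> bool" where
  "seq_stack_sortable k \<pi> \<longleftrightarrow>
     stack_step\<^sup>*\<^sup>* (\<pi>, replicate k [], []) ([], replicate k [], [1..<Suc (length \<pi>)])"

text \<open>
  Some number of stacks always suffices, so the \<open>LEAST\<close> in the definition of \<open>min_stacks\<close> below is a
  genuine minimum: the first input element waits at the bottom of the last stack, into which the
  remaining stacks recursively sort the other elements.
\<close>

lemma stack_step_append_stack:
  assumes "stack_step (i,S,q) (i',S',q')"
  shows "(q' = q \<and> stack_step (i,S@[T],r) (i',S'@[T],r)) \<or>
         (\<exists>x. q' = q @ [x] \<and> stack_step (i,S@[T],r) (i',S'@[x#T],r))"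
  using assms
proof cases
  case (read_input x)
  then show ?thesis using stack_step.read_input[of "S@[T]" x i' r] by (auto simp: nth_append list_update_append)
next
  case (transfer j x xs)
  then show ?thesis using stack_step.transfer[of j "S@[T]" x xs i r] by (auto simp: nth_append list_update_append)
next
  case (emit x xs)
  then show ?thesis using stack_step.transfer[of "length S - 1" "S@[T]" x xs i r]
    by (auto simp: nth_append list_update_append)
qed

lemma stack_step_carry_first:
  assumes "j < k"
  shows "stack_step\<^sup>*\<^sup>* (x#i, replicate k [], q) (i, (replicate k [])[j := [x]], q)"
  using assms
proof (induction j)
  case 0
  then have "stack_step (x#i, replicate k [], q) (i, (replicate k [])[0 := x # replicate k [] ! 0], q)"
    by (intro stack_step.read_input) simp
  also have "replicate k [] ! 0 = ([] :: nat list)" using 0 by simp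
  finally show ?case by (rule r_into_rtranclp)
next
  case (Suc j)
  let ?R = "(replicate k [])[j := [x]]"
  have "stack_step (i, ?R, q) (i, ?R[j := [], Suc j := x # ?R ! Suc j], q)"
    by (rule stack_step.transfer) (use Suc in auto)
  moreover have "?R[j := [], Suc j := x # ?R ! Suc j] = (replicate k [])[Suc j := [x]]"
    using Suc.prems by (intro nth_equalityI) (auto simp: nth_list_update)
  ultimately have "stack_step (i, ?R, q) (i, (replicate k [])[Suc j := [x]], q)" by (simp only:)
  moreover have "stack_step\<^sup>*\<^sup>* (x#i, replicate k [], q) (i, ?R, q)" using Suc by simp
  ultimately show ?case by (rule rtranclp.rtrancl_into_rtrancl[rotated])
qed

lemma stack_step_emit_last: "stack_step (i, S@[y#T], r) (i, S@[T], r@[y])"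
  using stack_step.emit[of "S@[y#T]" y T i r] by simp

lemma insort_eq_snoc: "sorted q \<Longrightarrow> \<forall>y\<in>set q. y < (z::nat) \<Longrightarrow> insort z q = q @ [z]"
  by (induction q) auto

lemma insort_snoc_less: "sorted (q@[z]) \<Longrightarrow> x < (z::nat) \<Longrightarrow> insort x (q@[z]) = insort x q @ [z]"
  by (induction q) auto

lemma stack_step_run_above:
  assumes "stack_step\<^sup>*\<^sup>* (i,S,[]) (i',S',q)" "sorted q" "x \<notin> set q"
  shows "((\<forall>y\<in>set q. y < x) \<longrightarrow> stack_step\<^sup>*\<^sup>* (i,S@[[x]],[]) (i',S'@[[x]],q)) \<and>
     (\<not> (\<forall>y\<in>set q. y < x) \<longrightarrow> stack_step\<^sup>*\<^sup>* (i,S@[[x]],[]) (i',S'@[[]],insort x q))"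
  using assms
proof (induction "(i',S',q)" arbitrary: i' S' q rule: rtranclp_induct)
  case base
  then show ?case by auto
next
  case (step c)
  obtain i1 S1 q1 where c: "c = (i1,S1,q1)" by (cases c)
  have st: "stack_step (i1,S1,q1) (i',S',q)" using step c by simp
  show ?case
  proof (cases "q = q1")
    case True
    then have s: "stack_step (i1,S1@[T],r) (i',S'@[T],r)" for T r
      using stack_step_append_stack[OF st, of T r] by auto
    have IH: "((\<forall>y\<in>set q. y < x) \<longrightarrow> stack_step\<^sup>*\<^sup>* (i,S@[[x]],[]) (i1,S1@[[x]],q)) \<and>
      (\<not> (\<forall>y\<in>set q. y < x) \<longrightarrow> stack_step\<^sup>*\<^sup>* (i,S@[[x]],[]) (i1,S1@[[]],insort x q))"
      using step(3)[OF c] step(4,5) unfolding True by blast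
    show ?thesis
    proof (cases "\<forall>y\<in>set q. y < x")
      case all: True
      have "stack_step\<^sup>*\<^sup>* (i,S@[[x]],[]) (i1,S1@[[x]],q)" using IH all by blast
      from rtranclp.rtrancl_into_rtrancl[OF this s] show ?thesis using all by blast
    next
      case not_all: False
      have "stack_step\<^sup>*\<^sup>* (i,S@[[x]],[]) (i1,S1@[[]],insort x q)"
        using IH not_all by blast
      from rtranclp.rtrancl_into_rtrancl[OF this s] show ?thesis using not_all by blast
    qed
  next
    case False
    then obtain z where z: "q = q1@[z]"
      using stack_step_append_stack[OF st, of "[]" "[]"] by blast
    have s: "stack_step (i1,S1@[T],r) (i',S'@[z#T],r)" for T r
      using stack_step_append_stack[OF st, of T r] z by simp
    have so: "sorted q1" "x \<notin> set q1" "x \<noteq> z" "\<forall>y\<in>set q1. y \<le> z" using step(4,5) z by (auto simp: sorted_append)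
    note IH = step(3)[OF c so(1,2)]
    consider "z < x" | "x < z" "\<forall>y\<in>set q1. y < x" | "x < z" "\<not>(\<forall>y\<in>set q1. y < x)" using so by linarith
    then show ?thesis
    proof cases
      case 1
      then have all: "\<forall>y\<in>set q1. y < x" "\<forall>y\<in>set q. y < x" using so z by auto
      have "stack_step\<^sup>*\<^sup>* (i,S@[[x]],[]) (i1,S1@[[x]],q1)" using IH all by simp
      also have "stack_step \<dots> (i',S'@[[z,x]],q1)" by (rule s)
      also have "stack_step \<dots> (i',S'@[[x]],q1@[z])" by (rule stack_step_emit_last)
      finally show ?thesis using all z by simp
    next
      case 2
      have "stack_step\<^sup>*\<^sup>* (i,S@[[x]],[]) (i1,S1@[[x]],q1)" using IH 2 by simp
      also have "stack_step \<dots> (i1,S1@[[]],q1@[x])" by (rule stack_step_emit_last)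
      also have "stack_step \<dots> (i',S'@[[z]],q1@[x])" by (rule s)
      also have "stack_step \<dots> (i',S'@[[]],(q1@[x])@[z])" by (rule stack_step_emit_last)
      also have "(q1@[x])@[z] = insort x q"
        using 2 z insort_snoc_less[of q1 z x] step(4) insort_eq_snoc[OF so(1) 2(2)] by simp
      finally show ?thesis using 2 z by simp
    next
      case 3
      have "stack_step\<^sup>*\<^sup>* (i,S@[[x]],[]) (i1,S1@[[]],insort x q1)" using IH 3 by blast
      also have "stack_step \<dots> (i',S'@[[z]],insort x q1)" by (rule s)
      also have "stack_step \<dots> (i',S'@[[]],insort x q1@[z])" by (rule stack_step_emit_last)
      also have "insort x q1@[z] = insort x q" using 3 z insort_snoc_less[of q1 z x] step(4) by simp
      finally show ?thesis using 3 z by simp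
    qed
  qed
qed

lemma stack_step_sort:
  "distinct xs \<Longrightarrow>
    stack_step\<^sup>*\<^sup>* (xs, replicate (length xs) [], []) ([], replicate (length xs) [], sort xs)"
proof (induction xs)
  case (Cons x xs)
  let ?k = "length xs"
  have repl: "replicate (Suc ?k) [] = replicate ?k [] @ [[]]" by (simp add: replicate_append_same)
  have upd: "(replicate ?k [] @ [[]])[?k := [x]] = replicate ?k [] @ [[x]]"
    by (simp add: list_update_append)
  have carry: "stack_step\<^sup>*\<^sup>* (x#xs, replicate (Suc ?k) [], []) (xs, replicate ?k [] @ [[x]], [])"
    using stack_step_carry_first[of ?k "Suc ?k" x xs "[]"] unfolding repl upd by (simp only: lessI)
  have IH: "stack_step\<^sup>*\<^sup>* (xs, replicate ?k [], []) ([], replicate ?k [], sort xs)"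
    using Cons by simp
  have x: "x \<notin> set (sort xs)" using Cons.prems by simp
  have "stack_step\<^sup>*\<^sup>* (xs, replicate ?k [] @ [[x]], []) ([], replicate ?k [] @ [[]], insort x (sort xs))"
  proof (cases "\<forall>y\<in>set (sort xs). y < x")
    case True
    have "stack_step\<^sup>*\<^sup>* (xs, replicate ?k [] @ [[x]], []) ([], replicate ?k [] @ [[x]], sort xs)"
      using stack_step_run_above[OF IH sorted_sort x] True by blast
    also have "stack_step \<dots> ([], replicate ?k [] @ [[]], sort xs @ [x])"
      by (rule stack_step_emit_last)
    also have "sort xs @ [x] = insort x (sort xs)"
      by (rule insort_eq_snoc[OF sorted_sort True, symmetric])
    finally show ?thesis .
  next
    case False
    then show ?thesis using stack_step_run_above[OF IH sorted_sort x] by blast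
  qed
  with carry have "stack_step\<^sup>*\<^sup>* (x#xs, replicate (Suc ?k) [], [])
      ([], replicate ?k [] @ [[]], insort x (sort xs))"
    by (rule rtranclp_trans)
  then show ?case unfolding repl[symmetric] by simp
qed simp

lemma seq_stack_sortable_permutation:
  assumes "\<pi> \<in> permutations_of_set {1..n}"
  shows "seq_stack_sortable n \<pi>"
proof -
  have d: "distinct \<pi>" "set \<pi> = {1..n}" "length \<pi> = n"
    using permutations_of_setD[OF assms] length_finite_permutations_of_set[OF assms] by simp_all
  have sort_eq: "sort \<pi> = [1..<Suc n]"
  proof (rule sorted_distinct_set_unique)
    show "set (sort \<pi>) = set [1..<Suc n]" unfolding set_sort d(2) by auto
  qed (simp_all only: sorted_sort distinct_sort d(1) sorted_upt distinct_upt)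
  show ?thesis
    using stack_step_sort[OF d(1)] unfolding seq_stack_sortable_def sort_eq d(3) .
qed

definition min_stacks :: "nat list \<Rightarrow> nat" where
  "min_stacks \<pi> = (LEAST k. seq_stack_sortable k \<pi>)"

definition expected_min_stacks :: "nat \<Rightarrow> real" where
  "expected_min_stacks n =
     measure_pmf.expectation (pmf_of_set (permutations_of_set {1..n})) (\<lambda>\<pi>. real (min_stacks \<pi>))"

end

theory Submission
  imports Defs "HOL-Real_Asymp.Real_Asymp"
begin

text \<open>
  In a run of \<open>k\<close> sequential stacks every single stack carries out a word of \<open>n\<close> pushes and \<open>n\<close> pops.
  Such a word and the output of a stack determine its input, by running the word backwards from the
  empty stack. Hence the \<open>k\<close> words determine \<open>\<pi>\<close>, and at most \<open>4\<^bsup>nk\<^esup>\<close> permutations of length \<open>n\<close> can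
  be sorted by \<open>k\<close> stacks. As \<open>n! \<ge> (n/e)\<^sup>n\<close>, this is a vanishing fraction of all permutations for
  \<open>k = \<lfloor>log n / 2 - 2\<rfloor>\<close>.
\<close>

text \<open>
  \<open>one_stack w T xs ys\<close>: started with stack \<open>T\<close>, the word \<open>w\<close> (\<open>True\<close> is a push) reads exactly \<open>xs\<close>,
  writes exactly \<open>ys\<close> and ends with the empty stack.
\<close>

inductive one_stack :: "bool list \<Rightarrow> 'a list \<Rightarrow> 'a list \<Rightarrow> 'a list \<Rightarrow> bool" where
  Nil: "one_stack [] [] [] []"
| push: "one_stack w (x # T) xs ys \<Longrightarrow> one_stack (True # w) T (x # xs) ys"
| pop: "one_stack w T xs ys \<Longrightarrow> one_stack (False # w) (x # T) xs (x # ys)"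

lemma one_stack_length:
  "one_stack w T xs ys \<Longrightarrow>
    length ys = length xs + length T \<and> length w = length xs + length ys"
  by (induction rule: one_stack.induct) auto

text \<open>The tail of \<open>w\<close> fixes stack and input after the first step. A push is
  undone by moving the top of that stack to the front of the input, a pop by moving the head of the
  output back onto the stack.\<close>

lemma one_stack_backward_deterministic:
  "one_stack w T xs ys \<Longrightarrow> one_stack w T' xs' ys \<Longrightarrow> T = T' \<and> xs = xs'"
proof (induction arbitrary: T' xs' rule: one_stack.induct)
  case Nil
  then show ?case by (auto elim: one_stack.cases)
next
  case (push w x T xs ys)
  from push.prems show ?case
    by cases (use push.IH in blast, simp)
next
  case (pop w T xs ys x)
  from pop.prems show ?case
    by cases (simp, use pop.IH in blast)
qed

text \<open>\<open>s i\<close> lists the elements that enter stack \<open>i\<close>, and \<open>s (length S)\<close> the elements that are output.\<close>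

lemma stack_run_words:
  assumes "stack_step\<^sup>*\<^sup>* (inp, S, out) ([], replicate k [], q)"
  shows "length S = k \<and> (\<exists>w s. s 0 = inp \<and> q = out @ s k \<and>
    (\<forall>i<k. one_stack (w i) (S ! i) (s i) (s (Suc i))))"
  using assms
\<comment> \<open>Steps are added at the front of the run, just as \<open>one_stack\<close> adds
  letters at the front of a word.\<close>
proof (induction "(inp, S, out)" arbitrary: inp S out rule: converse_rtranclp_induct)
  case base
  show ?case
    by (auto intro!: exI[of _ "\<lambda>_. []"] one_stack.Nil)
next
  case (step c)
  obtain inp' S' out' where c: "c = (inp', S', out')" by (cases c)
  from step.hyps(3)[OF c] obtain w s where len: "length S' = k"
    and s: "s 0 = inp'" "q = out' @ s k"
    and os: "\<And>i. i < k \<Longrightarrow> one_stack (w i) (S' ! i) (s i) (s (Suc i))"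
    by blast
  from step.hyps(1)[unfolded c] show ?case
  proof cases
    case (read_input x)
    have "one_stack ((w(0 := True # w 0)) i) (S ! i) ((s(0 := inp)) i) ((s(0 := inp)) (Suc i))"
      if "i < k" for i
      using os[OF that] that read_input len s
      by (cases "i = 0") (auto intro: one_stack.push)
    then show ?thesis
      using read_input len s
      by (intro conjI exI[of _ "w(0 := True # w 0)"] exI[of _ "s(0 := inp)"]) auto
  next
    case (transfer j x xs)
    \<comment> \<open>The moved \<open>x\<close> becomes the first output of stack \<open>j\<close>
      and the first input of stack \<open>Suc j\<close>; both are the list
      \<open>s (Suc j)\<close>.\<close>
    let ?w = "w(j := False # w j, Suc j := True # w (Suc j))"
    let ?s = "s(Suc j := x # s (Suc j))"
    have "one_stack (?w i) (S ! i) (?s i) (?s (Suc i))" if "i < k" for i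
      using os[OF that] that transfer len
      by (cases "i = j"; cases "i = Suc j") (auto intro: one_stack.push one_stack.pop)
    then show ?thesis
      using transfer len s
      by (intro conjI exI[of _ ?w] exI[of _ ?s]) auto
  next
    case (emit x xs)
    let ?w = "w(k - 1 := False # w (k - 1))"
    let ?s = "s(k := x # s k)"
    have "one_stack (?w i) (S ! i) (?s i) (?s (Suc i))" if "i < k" for i
      using os[OF that] that emit len
      by (cases "i = k - 1") (auto intro: one_stack.pop)
    then show ?thesis
      using emit len s
      by (intro conjI exI[of _ ?w] exI[of _ ?s]) auto
  qed
qed

lemma one_stack_chain_length:
  assumes "\<And>i. i < k \<Longrightarrow> one_stack (w i) [] (s i) (s (Suc i))" "i \<le> k"
  shows "length (s i) = length (s 0)"
  using assms(2)
proof (induction i)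
  case (Suc i)
  then show ?case using one_stack_length[OF assms(1)[of i]] by simp
qed simp

text \<open>The common output \<open>s k\<close> is traced back through the stacks, from the last to
  the first.\<close>

lemma one_stack_chain_deterministic:
  assumes "\<And>i. i < k \<Longrightarrow> one_stack (w i) [] (s i) (s (Suc i))"
    and "\<And>i. i < k \<Longrightarrow> one_stack (w i) [] (s' i) (s' (Suc i))"
    and "s k = s' k"
  shows "s 0 = s' 0"
proof -
  have "s i = s' i" if "i \<le> k" for i
    using that
  proof (induction rule: inc_induct)
    case base
    then show ?case using assms(3) by simp
  next
    case (step i)
    then show ?case
      using one_stack_backward_deterministic assms(1,2) by metis
  qed
  then show ?thesis by simp
qed

text \<open>The lists between the stacks are quantified away, since only the words get
  counted.\<close>

definition sorting_words :: "nat list \<Rightarrow> bool list list \<Rightarrow> bool" where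
  "sorting_words \<pi> ws \<longleftrightarrow> (\<exists>s. s 0 = \<pi> \<and> s (length ws) = [1..<Suc (length \<pi>)] \<and>
     (\<forall>i<length ws. one_stack (ws ! i) [] (s i) (s (Suc i))))"

lemma ex_sorting_words:
  assumes "seq_stack_sortable k \<pi>"
  obtains ws where "length ws = k" "set ws \<subseteq> {w. length w = 2 * length \<pi>}" "sorting_words \<pi> ws"
proof -
  obtain w s where s: "s 0 = \<pi>" "s k = [1..<Suc (length \<pi>)]"
    and "\<forall>i<k. one_stack (w i) (replicate k [] ! i) (s i) (s (Suc i))"
    using stack_run_words[OF assms[unfolded seq_stack_sortable_def]]
    unfolding append_Nil by metis
  then have os: "\<And>i. i < k \<Longrightarrow> one_stack (w i) [] (s i) (s (Suc i))" by simp
  have "length (w i) = 2 * length \<pi>" if "i < k" for i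
    using one_stack_length[OF os[OF that]] one_stack_chain_length[of k w s i] os s(1) that by auto
  then show ?thesis
    using s os by (intro that[of "map w [0..<k]"]) (auto simp: sorting_words_def)
qed

text \<open>Equal lengths give both chains the same sorted output.\<close>

lemma sorting_words_unique:
  assumes "sorting_words \<pi> ws" "sorting_words \<sigma> ws" "length \<pi> = length \<sigma>"
  shows "\<pi> = \<sigma>"
  using assms one_stack_chain_deterministic[of "length ws" "(!) ws"]
  unfolding sorting_words_def by metis

text \<open>Choosing sorting words for each permutation is injective, and there are
  \<open>(2 ^ (2 * n)) ^ k\<close> lists of \<open>k\<close> words.\<close>

lemma card_seq_stack_sortable_le:
  "card {\<pi> \<in> permutations_of_set {1..n}. seq_stack_sortable k \<pi>} \<le> 4 ^ (n * k)"
    (is "card ?A \<le> _")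
proof -
  let ?W = "{ws. set ws \<subseteq> {w :: bool list. length w = 2 * n} \<and> length ws = k}"
  have W: "{w :: bool list. length w = 2 * n} = {w. set w \<subseteq> UNIV \<and> length w = 2 * n}" by simp
  have fin: "finite {w :: bool list. length w = 2 * n}"
    unfolding W by (rule finite_lists_length_eq) simp
  have card: "card {w :: bool list. length w = 2 * n} = 4 ^ n"
    unfolding W by (subst card_lists_length_eq) (simp_all add: power_mult)
  have len: "length \<pi> = n" if "\<pi> \<in> ?A" for \<pi>
    using that length_finite_permutations_of_set by fastforce
  have "\<exists>ws. ws \<in> ?W \<and> sorting_words \<pi> ws" if "\<pi> \<in> ?A" for \<pi>
    using that len[OF that] ex_sorting_words[of k \<pi>] by blast
  then have "\<forall>\<pi>\<in>?A. \<exists>ws. ws \<in> ?W \<and> sorting_words \<pi> ws" by blast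
  from bchoice[OF this] obtain f
    where f: "\<forall>\<pi>\<in>?A. f \<pi> \<in> ?W \<and> sorting_words \<pi> (f \<pi>)" ..
  have "inj_on f ?A"
  proof (rule inj_onI)
    fix \<pi> \<sigma>
    assume A: "\<pi> \<in> ?A" "\<sigma> \<in> ?A" and "f \<pi> = f \<sigma>"
    then have "sorting_words \<pi> (f \<pi>)" "sorting_words \<sigma> (f \<pi>)" using f by auto
    then show "\<pi> = \<sigma>" by (rule sorting_words_unique) (simp only: len A)
  qed
  moreover have "f ` ?A \<subseteq> ?W" using f by blast
  moreover have "finite ?W" by (rule finite_lists_length_eq[OF fin])
  ultimately have "card ?A \<le> card ?W" by (rule card_inj_on_le)
  also have "card ?W = 4 ^ (n * k)"
    by (simp add: card_lists_length_eq[OF fin] card power_mult)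
  finally show ?thesis .
qed

text \<open>A union bound over the possible values of the minimum replaces monotonicity of
  sortability in the number of stacks. Its factor \<open>Suc k\<close> will be at most
  \<open>n\<close>.\<close>

lemma card_min_stacks_le:
  "card {\<pi> \<in> permutations_of_set {1..n}. min_stacks \<pi> \<le> k} \<le> Suc k * 4 ^ (n * k)"
proof -
  let ?A = "\<lambda>j. {\<pi> \<in> permutations_of_set {1..n}. seq_stack_sortable j \<pi>}"
  have "seq_stack_sortable (min_stacks \<pi>) \<pi>" if "\<pi> \<in> permutations_of_set {1..n}" for \<pi>
    unfolding min_stacks_def using seq_stack_sortable_permutation[OF that] by (rule LeastI)
  then have "card {\<pi> \<in> permutations_of_set {1..n}. min_stacks \<pi> \<le> k} \<le> card (\<Union>j\<in>{..k}. ?A j)"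
    by (intro card_mono) auto
  also have "\<dots> \<le> (\<Sum>j\<le>k. card (?A j))" by (rule card_UN_le) simp
  also have "\<dots> \<le> (\<Sum>j\<le>k. 4 ^ (n * k))"
    by (intro sum_mono order.trans[OF card_seq_stack_sortable_le]) (auto intro: power_increasing)
  finally show ?thesis by simp
qed

text \<open>Permutations outside the set just counted contribute at least \<open>Suc k\<close> each,
  the others at least 0.\<close>

lemma expected_min_stacks_ge:
  "expected_min_stacks n \<ge> real (Suc k) * (1 - real (Suc k) * 4 ^ (n * k) / fact n)"
proof -
  let ?P = "permutations_of_set {1..n}"
  let ?A = "{\<pi> \<in> ?P. min_stacks \<pi> \<le> k}"
  have cardP: "card ?P = fact n" by simp
  have "card ?P = card ?A + card (?P - ?A)"
    using card_Int_Diff[of ?P ?A] by (simp add: Int_absorb1)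
  then have "real (fact n) = real (card ?A + card (?P - ?A))" by (simp only: cardP)
  then have eq: "real (card (?P - ?A)) = fact n - real (card ?A)"
    unfolding of_nat_add of_nat_fact by linarith
  have "real (card ?A) \<le> real (Suc k * 4 ^ (n * k))"
    using card_min_stacks_le by (rule of_nat_mono)
  then have "real (card ?A) \<le> real (Suc k) * 4 ^ (n * k)"
    unfolding of_nat_mult of_nat_power of_nat_numeral .
  then have card: "real (card (?P - ?A)) \<ge> fact n - real (Suc k) * 4 ^ (n * k)"
    unfolding eq by linarith
  have "real (Suc k) * (fact n - real (Suc k) * 4 ^ (n * k)) \<le> real (Suc k) * real (card (?P - ?A))"
    using card by (rule mult_left_mono) simp
  also have "\<dots> = (\<Sum>\<pi>\<in>?P - ?A. real (Suc k))" by simp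
  also have "\<dots> \<le> (\<Sum>\<pi>\<in>?P - ?A. real (min_stacks \<pi>))"
    by (intro sum_mono) auto
  also have "\<dots> \<le> (\<Sum>\<pi>\<in>?P. real (min_stacks \<pi>))"
    by (intro sum_mono2) auto
  also have "\<dots> = fact n * expected_min_stacks n"
    unfolding expected_min_stacks_def by (subst integral_pmf_of_set) auto
  finally show ?thesis by (simp add: field_simps)
qed

text \<open>A single term of the exponential series at \<open>n\<close>, the one of index
  \<open>n\<close>, is at most the sum.\<close>

lemma power_self_le_fact_exp: "real n ^ n \<le> fact n * exp (real n)"
proof -
  have "(\<lambda>m. real n ^ m /\<^sub>R fact m) sums exp (real n)" by (rule exp_converges)
  then have "real n ^ n /\<^sub>R fact n \<le> exp (real n)"
    using sum_le_suminf[of "\<lambda>m. real n ^ m /\<^sub>R fact m" "{n}"]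
    by (auto simp: sums_iff)
  then show ?thesis by (simp add: field_simps)
qed

lemma expected_min_stacks_ge_log:
  assumes n: "n \<ge> 16"
  shows "expected_min_stacks n \<ge>
    (1 / 2 - (2 / log 2 (real n) + real n * (exp 1 / 16) ^ n / 2)) * log 2 (real n)"
proof -
  define L where "L = log 2 (real n)"
  \<comment> \<open>This gives \<open>4 ^ k \<le> n / 16\<close>; subtracting 2 yields the factor
    16, which beats the \<open>exp 1\<close> lost in bounding \<open>fact n\<close>.\<close>
  define k where "k = nat \<lfloor>L / 2 - 2\<rfloor>"
  define d where "d = real n * (exp 1 / 16) ^ n"
  \<comment> \<open>With \<open>L \<ge> 4\<close> the argument of the floor is nonnegative, so
    \<open>nat\<close> does not truncate.\<close>
  have "4 = log 2 (2 ^ 4)" by (subst log_pow_cancel) auto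
  also have "\<dots> \<le> L" unfolding L_def using n by (subst log_le_cancel_iff) auto
  finally have L4: "L \<ge> 4" .
  have k: "real k \<le> L / 2 - 2" "L / 2 - 2 \<le> real (Suc k)"
    using L4 unfolding k_def by linarith+
  have "L \<le> real n" unfolding L_def using n log2_of_power_le[of n n]  by simp
  with k(1) L4 have Suc_k: "real (Suc k) \<le> real n" by simp
  have "(4::real) ^ k = 2 powr (2 * real k)"
    by (simp add: powr_realpow[symmetric] powr_powr[symmetric])
  also have "\<dots> \<le> 2 powr (L - 4)" using k(1) by (intro powr_mono) auto
  also have "\<dots> = real n / 16" using n by (simp add: powr_diff L_def)
  finally have "((4::real) ^ k) ^ n \<le> (real n / 16) ^ n" by (rule power_mono) simp
  also have "\<dots> = real n ^ n / 16 ^ n" by (rule power_divide)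
  also have "\<dots> \<le> fact n * exp (real n) / 16 ^ n"
    by (intro divide_right_mono power_self_le_fact_exp) simp
  also have "\<dots> = fact n * (exp 1 / 16) ^ n"
    by (simp add: power_divide exp_of_nat_mult[symmetric])
  finally have "4 ^ (n * k) / fact n \<le> (exp 1 / 16 :: real) ^ n"
    by (simp add: field_simps power_mult[symmetric])
  then have "real (Suc k) * (4 ^ (n * k) / fact n) \<le> d"
    unfolding d_def using Suc_k by (intro mult_mono) auto
  then have d: "1 - real (Suc k) * 4 ^ (n * k) / fact n \<ge> 1 - d" by simp
  show ?thesis
  proof (cases "d \<le> 1")
    case True
    have "(1 / 2 - (2 / L + d / 2)) * L = L / 2 - 2 - L * d / 2"
      using L4 by (simp add: field_simps)
    \<comment> \<open>The two sides differ by \<open>2 * d\<close>.\<close>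
    also have "\<dots> \<le> (L / 2 - 2) * (1 - d)"
      unfolding d_def by (simp add: algebra_simps)
    also have "\<dots> \<le> real (Suc k) * (1 - real (Suc k) * 4 ^ (n * k) / fact n)"
      using k d True L4 by (intro mult_mono) auto
    also have "\<dots> \<le> expected_min_stacks n" by (rule expected_min_stacks_ge)
    finally show ?thesis unfolding L_def d_def .
  next
    \<comment> \<open>For \<open>d > 1\<close> the claimed lower bound is negative or 0, hence
      trivial.\<close>
    case False
    moreover have "0 < 2 / L" using L4 by simp
    ultimately have "1 / 2 - (2 / L + d / 2) \<le> 0" by linarith
    then have "(1 / 2 - (2 / L + d / 2)) * L \<le> 0"
      using L4 by (intro mult_nonpos_nonneg) auto
    also have "0 \<le> expected_min_stacks n"
      unfolding expected_min_stacks_def by (intro Bochner_Integration.integral_nonneg) simp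
    finally show ?thesis unfolding L_def d_def .
  qed
qed

theorem theorem2:
  shows "\<exists>\<epsilon> :: nat \<Rightarrow> real. \<epsilon> \<in> o(\<lambda>_. 1) \<and>
           (\<forall>\<^sub>F n in sequentially. expected_min_stacks n \<ge> (1 / 2 - \<epsilon> n) * log 2 (real n))"
proof (intro exI conjI)
  \<comment> \<open>The witness for \<open>\<epsilon>\<close> is the error term of
    \<open>expected_min_stacks_ge_log\<close>; in its second summand the geometric decay outweighs
    the factor \<open>n\<close>.\<close>
  have "exp 1 / 16 < (1 :: real)" using exp_le by simp
  then have "(\<lambda>n. real n * (exp 1 / 16 :: real) ^ n) \<longlonglongrightarrow> 0"
    by (intro powser_times_n_limit_0) simp
  then have "(\<lambda>n. real n * (exp 1 / 16 :: real) ^ n / 2) \<longlonglongrightarrow> 0"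
    by (rule tendsto_divide_zero)
  moreover have "(\<lambda>n. 2 / log 2 (real n)) \<longlonglongrightarrow> 0" by real_asymp
  ultimately have "(\<lambda>n. 2 / log 2 (real n) + real n * (exp 1 / 16) ^ n / 2) \<longlonglongrightarrow> 0"
    using tendsto_add_zero by blast
  then show "(\<lambda>n. 2 / log 2 (real n) + real n * (exp 1 / 16) ^ n / 2) \<in> o(\<lambda>_. 1)"
    by (intro smalloI_tendsto) simp_all
  show "\<forall>\<^sub>F n in sequentially. expected_min_stacks n \<ge>
      (1 / 2 - (2 / log 2 (real n) + real n * (exp 1 / 16) ^ n / 2)) * log 2 (real n)"
    using eventually_ge_at_top[of 16] by eventually_elim (rule expected_min_stacks_ge_log)
qed

end
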